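(* Any continuous homomorphism $f:G_1\to G_2$ between (matrix) Lie groups is analytic.
   Context: A (matrix) Lie group is a closed subgroup of $\mathrm{GL}_d(\mathbb{R})$ for some $d$. For a Lie group $G\subset\mathrm{GL}_d(\mathbb{R})$, let $\mathcal{L}(G)=\{X\in\mathrm{M}_d(\mathbb{R}):\exp(tX)\in G\ \forall t\in\mathbb{R}\}$ be its Lie algebra (a real vector space). Fix a neighbourhood $\mathcal{U}$ of $0$ in $\mathrm{M}_d(\mathbb{R})$, sufficiently small, such that $\exp:\mathcal{U}\to\exp(\mathcal{U})$ is an analytic bijection with analytic inverse, and put $\mathcal{O}=\mathcal{L}(G)\cap\mathcal{U}$. The coordinate charts of $G$ are the maps $\phi:\mathcal{O}\to G$, $\phi(x)=g\exp(x)$, for $g\in G$; they are bijections onto neighbourhoods of $g$ and make $G$ an analytic manifold. A map $f:G\to\mathbb{R}^k$ is analytic if $f\circ\phi$ is (real) analytic for all coordinate charts $\phi$; a map into a matrix Lie group $G_2\subset\mathrm{GL}_{d_2}(\mathbb{R})\subset\mathrm{M}_{d_2}(\mathbb{R})\cong\mathbb{R}^{d_2^2}$ is analytic if it is analytic as a map into $\mathbb{R}^{d_2^2}$. *)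

theory Defs
  imports "HOL-Analysis.Analysis" "HOL-Algebra.Group"
begin

section \<open>Matrix Lie groups\<close>

definition GL :: "(real^'n^'n) monoid" where
  "GL = \<lparr>carrier = {A. invertible A}, mult = (**), one = mat 1\<rparr>"

lemma group_GL: "group (GL :: (real^'n^'n) monoid)"
proof (rule groupI)
  fix A :: "real^'n^'n" assume "A \<in> carrier GL"
  then obtain B where "A ** B = mat 1" "B ** A = mat 1"
    by (auto simp: GL_def invertible_def)
  then show "\<exists>B \<in> carrier GL. B \<otimes>\<^bsub>GL\<^esub> A = \<one>\<^bsub>GL\<^esub>"
    by (auto simp: GL_def invertible_def)
next
  have "invertible (mat 1 :: real^'n^'n)"
    unfolding invertible_def by (rule exI[of _ "mat 1"]) simp
  then show "\<one>\<^bsub>GL\<^esub> \<in> carrier (GL :: (real^'n^'n) monoid)"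
    by (simp add: GL_def)
qed (simp_all add: GL_def invertible_mult matrix_mul_assoc)

definition matrix_lie_group :: "(real^'n^'n) set \<Rightarrow> bool" where
  "matrix_lie_group G \<longleftrightarrow> subgroup G GL \<and> closedin (top_of_set (carrier GL)) G"

text \<open>
  The type \<^typ>\<open>real^'n^'n\<close> carries the componentwise product, so neither \<open>(^)\<close> nor \<open>exp\<close> has
  the intended meaning on it; powers have to be taken with respect to \<open>(**)\<close>.
\<close>

definition mat_exp :: "real^'n^'n \<Rightarrow> real^'n^'n" where
  "mat_exp A = (\<Sum>k. (1 / fact k) *\<^sub>R (((**) A ^^ k) (mat 1)))"

definition lie_algebra :: "(real^'n^'n) set \<Rightarrow> (real^'n^'n) set" where
  "lie_algebra G = {X. \<forall>t::real. mat_exp (t *\<^sub>R X) \<in> G}"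


section \<open>Real analytic maps\<close>

text \<open>
  Analyticity on a relatively open subset \<open>S\<close> of a linear subspace \<open>V\<close>: near each point \<open>a\<close> of
  \<open>S\<close>, in the linear coordinates on \<open>V\<close> given by a basis \<open>B\<close>, the map is the sum of a power series
  in \<open>card B\<close> variables. Multi-indices are functions \<open>\<alpha>\<close> vanishing outside \<open>B\<close>, the monomial
  belonging to \<open>\<alpha>\<close> is the product of the \<open>(x\<^sub>b - a\<^sub>b)\<close> to the power \<open>\<alpha> b\<close>, and convergence is
  unconditional. The notion does not depend on the basis, so all bases are allowed. The values
  of \<open>f\<close> outside \<open>S\<close> are irrelevant.
\<close>

definition real_analytic_on ::
    "'a::euclidean_space set \<Rightarrow> 'a set \<Rightarrow> ('a \<Rightarrow> 'b::euclidean_space) \<Rightarrow> bool" where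
  "real_analytic_on V S f \<longleftrightarrow>
     subspace V \<and> openin (top_of_set V) S \<and>
     (\<forall>B. independent B \<and> span B = V \<longrightarrow>
       (\<forall>a\<in>S. \<exists>c :: ('a \<Rightarrow> nat) \<Rightarrow> 'b. \<exists>r>0. \<forall>x\<in>S. dist x a < r \<longrightarrow>
         ((\<lambda>\<alpha>. (\<Prod>b\<in>B. representation B (x - a) b ^ \<alpha> b) *\<^sub>R c \<alpha>) has_sum f x)
           {\<alpha>. \<forall>b. b \<notin> B \<longrightarrow> \<alpha> b = 0}))"


section \<open>Analytic maps on matrix Lie groups\<close>

definition exp_chart_domain :: "(real^'n^'n) set \<Rightarrow> bool" where
  "exp_chart_domain U \<longleftrightarrow>
     open U \<and> 0 \<in> U \<and> inj_on mat_exp U \<and> real_analytic_on UNIV U mat_exp \<and>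
     real_analytic_on UNIV (mat_exp ` U) (inv_into U mat_exp)"

definition lie_chart :: "real^'n^'n \<Rightarrow> real^'n^'n \<Rightarrow> real^'n^'n" where
  "lie_chart g x = g ** mat_exp x"

text \<open>
  \<open>U\<close> is the neighbourhood fixed for the charts. A map into a matrix group is regarded as a map
  into the ambient space of matrices.
\<close>

definition lie_analytic ::
    "(real^'n^'n) set \<Rightarrow> (real^'n^'n) set \<Rightarrow> (real^'n^'n \<Rightarrow> 'b::euclidean_space) \<Rightarrow> bool" where
  "lie_analytic U G f \<longleftrightarrow>
     (\<forall>g\<in>G. real_analytic_on (lie_algebra G) (lie_algebra G \<inter> U) (f \<circ> lie_chart g))"

end

theory Submission imports Defs begin

text \<open>
  In exponential charts a continuous homomorphism is the exponential of a linear map, and this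
  makes it analytic. Three ingredients carry the argument.

  For each \<open>X\<close> in the Lie algebra of \<open>G1\<close>, the curve \<open>t \<mapsto> f (exp (t X))\<close> is a continuous
  one-parameter group of matrices. Such a curve is automatically differentiable, hence of the form
  \<open>exp (t Y)\<close> with a unique \<open>Y\<close> (\<open>continuous_one_parameter_subgroup\<close>,
  \<open>exp_one_parameter_inject\<close>). Writing \<open>T X\<close> for this \<open>Y\<close> gives \<open>f (exp X) = exp (T X)\<close>.

  The Lie product formula (\<open>Lie_product_formula\<close>) expresses \<open>exp (X + Y)\<close> as a limit of products of
  values \<open>exp (X / n)\<close> and \<open>exp (Y / n)\<close>. As \<open>G1\<close> is closed, its Lie algebra is a subspace; as \<open>f\<close> is
  continuous and multiplicative, \<open>T\<close> is additive. Homogeneity of \<open>T\<close> comes from rescaling \<open>t\<close>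
  (\<open>linear_differential_exists\<close>).

  It follows that \<open>f (g exp x) = f g exp (T a + \<Sum>b. y b T b)\<close>, where the \<open>y b\<close> are the
  coordinates of \<open>x - a\<close> in a basis of the Lie algebra. The matrices \<open>T a\<close> and \<open>T b\<close> need not commute,
  so the exponential is first expanded as an absolutely convergent sum over words in these letters;
  collecting the words that contain each \<open>T b\<close> equally often yields a power series in \<open>y\<close> that
  converges everywhere (\<open>exp_affine_power_series\<close>). In particular the radius in the definition of
  analyticity can be taken to be \<open>1\<close>, and the expansion is valid on the whole Lie algebra.

  These arguments work in arbitrary Banach algebras. They apply to matrices because these form
  a Banach algebra under the operator norm, whose topology is the usual one.
\<close>

section \<open>Exponentials in Banach algebras\<close>

text \<open>
  Telescoping, which does not require \<open>x\<close> and \<open>y\<close> to commute, gives \<open>n\<close> summands with \<open>n - 1\<close>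
  factors of norm at most \<open>M\<close> each. Since \<open>M \<ge> 1\<close>, the exponent may be rounded up to \<open>n\<close>.
\<close>

lemma norm_power_diff_le:
  fixes x y :: "'a::real_normed_algebra_1"
  assumes "norm x \<le> M" "norm y \<le> M" "1 \<le> M"
  shows "norm (x ^ n - y ^ n) \<le> real n * M ^ n * norm (x - y)"
proof (induction n)
  case (Suc n)
  have M: "0 \<le> M" using assms by simp
  have y: "norm (y ^ n) \<le> M ^ n"
    using norm_power_ineq[of y n] power_mono[OF assms(2), of n] by simp
  have "x ^ Suc n - y ^ Suc n = x * (x ^ n - y ^ n) + (x - y) * y ^ n"
    by (simp add: algebra_simps)
  also have "norm \<dots> \<le> norm x * norm (x ^ n - y ^ n) + norm (x - y) * norm (y ^ n)"
    by (intro norm_triangle_le add_mono norm_mult_ineq)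
  also have "\<dots> \<le> M * (real n * M ^ n * norm (x - y)) + norm (x - y) * (M * M ^ n)"
  proof (intro add_mono mult_mono mult_left_mono)
    have "M ^ n \<le> M * M ^ n"
      using assms(3) M by (simp add: mult_le_cancel_right1 not_less)
    then show "norm (y ^ n) \<le> M * M ^ n" using y by simp
  qed (use assms M Suc in auto)
  also have "\<dots> = real (Suc n) * M ^ Suc n * norm (x - y)"
    by (simp add: algebra_simps)
  finally show ?case .
qed simp

lemma exp_power:
  fixes x :: "'a::{real_normed_algebra_1,banach}"
  shows "exp x ^ n = exp (real n *\<^sub>R x)"
proof (induction n)
  case (Suc n)
  have "exp (real (Suc n) *\<^sub>R x) = exp (x + real n *\<^sub>R x)"
    by (simp add: algebra_simps)
  also have "\<dots> = exp x * exp (real n *\<^sub>R x)"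
    by (rule exp_add_commuting) simp
  finally show ?case using Suc by simp
qed simp

text \<open>
  With \<open>t = 1 / n\<close>, compare the factor \<open>exp (t x) exp (t y)\<close> with \<open>exp (t (x + y))\<close>, the \<open>n\<close>-th power
  of which is \<open>exp (x + y)\<close>. Both agree to first order in \<open>t\<close>, so they differ by \<open>o (1 / n)\<close>. Taking
  \<open>n\<close>-th powers multiplies this by at most \<open>n\<close> times a constant, because both factors have norm at
  most \<open>exp (t (norm x + norm y))\<close>.
\<close>

theorem Lie_product_formula:
  fixes x y :: "'a::{real_normed_algebra_1,banach}"
  shows "(\<lambda>n. (exp ((1 / real n) *\<^sub>R x) * exp ((1 / real n) *\<^sub>R y)) ^ n) \<longlonglongrightarrow> exp (x + y)"
proof -
  define D where "D t = exp (t *\<^sub>R x) * exp (t *\<^sub>R y) - exp (t *\<^sub>R (x + y))" for t :: real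
  define K where "K = exp (norm x + norm y)"
  have "(D has_vector_derivative 0) (at 0)"
    unfolding D_def
    by (rule derivative_eq_intros exp_scaleR_has_vector_derivative_right refl | simp)+
  then have "(\<lambda>h. norm (D h) / \<bar>h\<bar>) \<midarrow>0\<rightarrow> 0"
    by (simp add: has_vector_derivative_def has_derivative_at) (simp add: D_def)
  moreover have "filterlim (\<lambda>n. 1 / real n) (at 0) sequentially"
    unfolding inverse_eq_divide[symmetric]
    using filterlim_compose[OF filterlim_inverse_at_right_top filterlim_real_sequentially]
    by (simp add: filterlim_at)
  ultimately have "(\<lambda>n. norm (D (1 / real n)) / \<bar>1 / real n\<bar>) \<longlonglongrightarrow> 0"
    by (rule filterlim_compose)
  then have lim: "(\<lambda>n. K * (real n * norm (D (1 / real n)))) \<longlonglongrightarrow> 0"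
    by (intro tendsto_mult_right_zero) (simp add: mult.commute)
  have bound: "norm ((exp ((1 / real n) *\<^sub>R x) * exp ((1 / real n) *\<^sub>R y)) ^ n - exp (x + y))
      \<le> K * (real n * norm (D (1 / real n)))" if "n > 0" for n
  proof -
    let ?t = "1 / real n"
    let ?M = "exp (?t * (norm x + norm y))"
    have a: "norm (exp (?t *\<^sub>R x) * exp (?t *\<^sub>R y)) \<le> ?M"
    proof -
      have "norm (exp (?t *\<^sub>R x) * exp (?t *\<^sub>R y)) \<le> norm (exp (?t *\<^sub>R x)) * norm (exp (?t *\<^sub>R y))"
        by (rule norm_mult_ineq)
      also have "\<dots> \<le> exp (norm (?t *\<^sub>R x)) * exp (norm (?t *\<^sub>R y))"
        by (intro mult_mono norm_exp) auto
      also have "\<dots> = ?M"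
        by (simp add: mult_exp_exp algebra_simps add_divide_distrib)
      finally show ?thesis .
    qed
    have b: "norm (exp (?t *\<^sub>R (x + y))) \<le> ?M"
    proof -
      have "norm (exp (?t *\<^sub>R (x + y))) \<le> exp (norm (?t *\<^sub>R (x + y)))"
        by (rule norm_exp)
      also have "\<dots> \<le> ?M"
        using norm_triangle_ineq[of x y] by (simp add: divide_right_mono)
      finally show ?thesis .
    qed
    have e: "exp (x + y) = exp (?t *\<^sub>R (x + y)) ^ n"
      using that by (subst exp_power) simp
    have "?M ^ n = K"
      using that by (simp add: exp_of_nat_mult[symmetric] K_def)
    then show ?thesis
      unfolding e D_def
      using norm_power_diff_le[OF a b, of n] by (simp add: mult_ac)
  qed
  have "(\<lambda>n. (exp ((1 / real n) *\<^sub>R x) * exp ((1 / real n) *\<^sub>R y)) ^ n - exp (x + y)) \<longlonglongrightarrow> 0"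
    by (rule Lim_null_comparison[OF _ lim]) (use bound in \<open>auto intro: eventually_sequentiallyI[of 1]\<close>)
  then show ?thesis by (simp add: LIM_zero_iff)
qed

lemma exp_one_parameter_inject:
  fixes x y :: "'a::{real_normed_algebra_1,banach}"
  assumes "\<And>t::real. exp (t *\<^sub>R x) = exp (t *\<^sub>R y)"
  shows "x = y"
  using vector_derivative_unique_at[OF exp_scaleR_has_vector_derivative_right[of x 0 UNIV]
     exp_scaleR_has_vector_derivative_right[of y 0 UNIV, folded assms]]
  by simp

text \<open>The right inverse is the Neumann series in \<open>1 - x\<close>.\<close>

lemma right_inverse_near_one:
  fixes x :: "'a::{real_normed_algebra_1,banach}"
  assumes "norm (1 - x) < 1"
  obtains y where "x * y = 1"
proof
  have s: "summable (\<lambda>n. (1 - x) ^ n)"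
    by (rule complete_algebra_summable_geometric[OF assms])
  have "(\<Sum>n. (1 - x) ^ n) = 1 + (1 - x) * (\<Sum>n. (1 - x) ^ n)"
    using suminf_split_head[OF s] suminf_mult[OF s, of "1 - x"] by simp
  then show "x * (\<Sum>n. (1 - x) ^ n) = 1"
    by (simp add: algebra_simps)
qed

text \<open>
  Integration supplies the missing differentiability. If \<open>P\<close> is the primitive of \<open>\<phi>\<close> vanishing at \<open>0\<close>,
  then \<open>\<phi> t * P e = P (t + e) - P t\<close>, and \<open>P e / e\<close> is close to \<open>\<phi> 0 = 1\<close> for small \<open>e\<close>, so that
  \<open>P e\<close> has a right inverse \<open>W\<close>. Hence \<open>\<phi> t = (P (t + e) - P t) * W\<close> is differentiable and satisfies
  \<open>\<phi>' = \<phi> * Y\<close> with \<open>Y = (\<phi> e - 1) * W\<close>, which forces \<open>\<phi> t * exp (- t Y)\<close> to be constant. Working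
  with \<open>t \<ge> 0\<close> keeps all integrals oriented; negative times follow from \<open>\<phi> t * \<phi> (- t) = 1\<close>.
\<close>

theorem continuous_one_parameter_subgroup:
  fixes \<phi> :: "real \<Rightarrow> 'a::{real_normed_algebra_1,banach}"
  assumes cont: "continuous_on UNIV \<phi>"
    and add: "\<And>s t. \<phi> (s + t) = \<phi> s * \<phi> t" and zero: "\<phi> 0 = 1"
  obtains Y where "\<And>t. \<phi> t = exp (t *\<^sub>R Y)"
proof -
  define P where "P u = integral {0..u} \<phi>" for u
  have cont': "continuous_on S \<phi>" for S
    using cont continuous_on_subset by blast
  have int: "\<phi> integrable_on {a..b}" for a b
    by (intro integrable_continuous_real cont')
  have P: "(P has_vector_derivative \<phi> u) (at u within {0..b})" if "u \<in> {0..b}" for u b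
    unfolding P_def by (rule integral_has_vector_derivative[OF cont' that])
  have "\<exists>d>0. \<forall>s\<in>UNIV. dist s 0 < d \<longrightarrow> dist (\<phi> s) (\<phi> 0) < 1 / 2"
    using cont unfolding continuous_on_iff by (meson UNIV_I half_gt_zero zero_less_one)
  then obtain d where d: "d > 0" "\<And>s. \<bar>s\<bar> < d \<Longrightarrow> norm (\<phi> s - 1) < 1 / 2"
    by (auto simp: dist_norm zero)
  define e where "e = d / 2"
  have e: "e > 0" using d by (simp add: e_def)
  have "norm (integral {0..e} (\<lambda>s. \<phi> s - 1)) \<le> 1 / 2 * (e - 0)"
  proof (rule integral_bound)
    show "norm (\<phi> t - 1) \<le> 1 / 2" if "t \<in> {0..e}" for t
      using d(2)[of t] that e by (auto simp: e_def)
  qed (use e in \<open>auto intro!: continuous_intros cont'\<close>)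
  moreover have "integral {0..e} (\<lambda>s. \<phi> s - 1) = P e - e *\<^sub>R 1"
    using e int[of 0 e] by (subst integral_diff) (auto simp: P_def)
  ultimately have "norm (P e - e *\<^sub>R 1) \<le> e / 2" by simp
  moreover have "1 - (1 / e) *\<^sub>R P e = (- 1 / e) *\<^sub>R (P e - e *\<^sub>R 1)"
    using e by (simp add: scaleR_diff_right)
  ultimately have "norm (1 - (1 / e) *\<^sub>R P e) \<le> 1 / 2"
    using e by (simp only: norm_scaleR) (simp add: field_simps)
  then obtain w where "((1 / e) *\<^sub>R P e) * w = 1"
    using right_inverse_near_one[of "(1 / e) *\<^sub>R P e"] by auto
  then have w: "P e * ((1 / e) *\<^sub>R w) = 1" by simp
  define W where "W = (1 / e) *\<^sub>R w"
  have shift: "\<phi> t * P e = P (t + e) - P t" if "t \<ge> 0" for t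
  proof -
    have "\<phi> t * P e = integral {0..e} (\<lambda>s. \<phi> t * \<phi> s)"
      unfolding P_def
      using integral_linear[OF int bounded_linear_mult_right, of 0 e "\<phi> t"] by (simp add: o_def)
    also have "\<dots> = integral {0..e} (\<phi> \<circ> (+) t)"
      by (simp add: o_def add)
    also have "\<dots> = integral {0 + t..e + t} \<phi>"
      by (rule integral_shift_Icc_real)
    also have "\<dots> = P (t + e) - P t"
      using Henstock_Kurzweil_Integration.integral_combine[of 0 t "t + e" \<phi>] int that e
      by (simp add: P_def algebra_simps)
    finally show ?thesis .
  qed
  have formula: "\<phi> t = (P (t + e) - P t) * W" if "t \<ge> 0" for t
  proof -
    have "\<phi> t = \<phi> t * (P e * W)"
      using w by (simp add: W_def)
    then show ?thesis
      using shift[OF that] by (metis mult.assoc)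
  qed
  define Y where "Y = (\<phi> e - 1) * W"
  have deriv: "(\<phi> has_vector_derivative \<phi> t * Y) (at t within {0..b})" if t: "t \<in> {0..b}" for t b
  proof -
    have "((\<lambda>u. P (u + e)) has_vector_derivative \<phi> (t + e)) (at t within {0..b})"
    proof -
      have "(P has_vector_derivative \<phi> (t + e)) (at (t + e) within {0..b + e})"
        by (rule P) (use t e in auto)
      then have "(P has_vector_derivative \<phi> (t + e)) (at (t + e) within (\<lambda>u. u + e) ` {0..b})"
        by (rule has_vector_derivative_within_subset) (use e in auto)
      moreover have "((\<lambda>u. u + e) has_vector_derivative 1) (at t within {0..b})"
        by (auto intro!: derivative_eq_intros)
      ultimately show ?thesis
        using vector_diff_chain_within[of "\<lambda>u. u + e" 1 t "{0..b}" P "\<phi> (t + e)"]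
        by (simp add: o_def)
    qed
    then have "((\<lambda>u. (P (u + e) - P u) * W) has_vector_derivative (\<phi> (t + e) - \<phi> t) * W)
        (at t within {0..b})"
      by (intro has_vector_derivative_mult_left has_vector_derivative_diff P t)
    moreover have "(\<phi> (t + e) - \<phi> t) * W = \<phi> t * Y"
      by (simp add: Y_def add[of t e] left_diff_distrib right_diff_distrib mult.assoc)
    ultimately have "((\<lambda>u. (P (u + e) - P u) * W) has_vector_derivative \<phi> t * Y) (at t within {0..b})"
      by simp
    then show ?thesis
      by (rule has_vector_derivative_transform[OF t, rotated]) (use formula in auto)
  qed
  have pos: "\<phi> t = exp (t *\<^sub>R Y)" if "t \<ge> 0" for t
  proof -
    have "((\<lambda>u. \<phi> u * exp (- u *\<^sub>R Y)) has_vector_derivative 0) (at u within {0..t})"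
      if "u \<in> {0..t}" for u
    proof -
      have "((\<lambda>u. exp (u *\<^sub>R (- Y))) has_vector_derivative - Y * exp (u *\<^sub>R (- Y)))
          (at u within {0..t})"
        by (rule exp_scaleR_has_vector_derivative_left[THEN has_vector_derivative_at_within])
      from has_vector_derivative_mult[OF deriv[OF that] this] show ?thesis
        by (simp add: algebra_simps)
    qed
    then obtain c where c: "\<And>u. u \<in> {0..t} \<Longrightarrow> \<phi> u * exp (- u *\<^sub>R Y) = c"
      using has_vector_derivative_zero_constant[of "{0..t}" "\<lambda>u. \<phi> u * exp (- u *\<^sub>R Y)"] by auto
    have "\<phi> t * exp (- (t *\<^sub>R Y)) = 1"
      using c[of 0] c[of t] that zero by simp
    then have "\<phi> t * (exp (- (t *\<^sub>R Y)) * exp (t *\<^sub>R Y)) = exp (t *\<^sub>R Y)"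
      by (simp add: mult.assoc[symmetric])
    then show ?thesis
      using exp_minus_inverse[of "- (t *\<^sub>R Y)"] by simp
  qed
  have "\<phi> t = exp (t *\<^sub>R Y)" for t
  proof (cases "t \<ge> 0")
    case False
    have "\<phi> t * (exp ((- t) *\<^sub>R Y) * exp (t *\<^sub>R Y)) = \<phi> (t + - t) * exp (t *\<^sub>R Y)"
      using pos[of "- t"] False by (simp only: add mult.assoc)
    then show ?thesis
      using exp_minus_inverse[of "- (t *\<^sub>R Y)"] zero by simp
  qed (rule pos)
  then show ?thesis by (rule that)
qed

section \<open>Power series of the exponential in several variables\<close>

text \<open>The expansion of \<open>(\<Sum>l\<in>L. Z l) ^ k\<close> by distributivity, in a form valid without commutativity.\<close>

lemma sum_prod_list_words:
  fixes Z :: "'b \<Rightarrow> 'a::semiring_1"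
  assumes "finite L"
  shows "(\<Sum>w | set w \<subseteq> L \<and> length w = k. prod_list (map Z w)) = (\<Sum>l\<in>L. Z l) ^ k"
proof (induction k)
  case 0
  have "{w. set w \<subseteq> L \<and> length w = 0} = {[]}" by auto
  then show ?case by simp
next
  case (Suc k)
  let ?W = "{w. set w \<subseteq> L \<and> length w = k}"
  have "(\<Sum>w | set w \<subseteq> L \<and> length w = Suc k. prod_list (map Z w)) =
      (\<Sum>(w, l)\<in>?W \<times> L. Z l * prod_list (map Z w))"
    unfolding lists_length_Suc_eq by (subst sum.reindex) (auto simp: inj_on_def case_prod_beta)
  also have "\<dots> = (\<Sum>l\<in>L. Z l) * (\<Sum>w\<in>?W. prod_list (map Z w))"
    by (simp add: sum.cartesian_product[symmetric] sum_product sum.swap[of _ ?W L])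
  finally show ?case using Suc by simp
qed

lemma norm_prod_list_le:
  fixes Z :: "'b \<Rightarrow> 'a::real_normed_algebra_1"
  shows "norm (prod_list (map Z w)) \<le> prod_list (map (\<lambda>l. norm (Z l)) w)"
proof (induction w)
  case (Cons l w)
  have "norm (prod_list (map Z (l # w))) \<le> norm (Z l) * norm (prod_list (map Z w))"
    by (simp add: norm_mult_ineq)
  also have "\<dots> \<le> norm (Z l) * prod_list (map (\<lambda>l. norm (Z l)) w)"
    by (intro mult_left_mono Cons norm_ge_zero)
  finally show ?case by simp
qed simp

text \<open>
  The terms of length \<open>k\<close> add up to the \<open>k\<close>-th term of the exponential series. Unconditional
  convergence over all words holds since the norms are dominated by the same expansion of the
  real number \<open>exp (\<Sum>l\<in>L. norm (Z l))\<close>.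
\<close>

lemma exp_has_sum_words:
  fixes Z :: "'b \<Rightarrow> 'a::{real_normed_algebra_1,banach}"
  assumes L: "finite L"
  shows "((\<lambda>w. (1 / fact (length w)) *\<^sub>R prod_list (map Z w)) has_sum exp (\<Sum>l\<in>L. Z l))
           {w. set w \<subseteq> L}"
proof -
  (* Words are indexed by pairs with their length, which turns grouping by length into an
     iterated sum. *)
  let ?W = "\<lambda>k. {w. set w \<subseteq> L \<and> length w = k}"
  let ?f = "\<lambda>(k, w). (1 / fact k) *\<^sub>R prod_list (map Z w)"
  let ?h = "\<lambda>(k, w). (1 / fact k) * prod_list (map (\<lambda>l. norm (Z l)) w)"
  let ?r = "\<Sum>l\<in>L. norm (Z l)"
  have fin: "finite (?W k)" for k
    by (rule finite_lists_length_eq[OF L])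
  have "?h summable_on Sigma UNIV ?W"
  proof (rule summable_on_SigmaI)
    show "((\<lambda>w. ?h (k, w)) has_sum (1 / fact k) * ?r ^ k) (?W k)" for k
      using has_sum_finite[OF fin, of "\<lambda>w. ?h (k, w)" k]
      by (simp add: sum_distrib_left[symmetric] sum_prod_list_words[OF L] sum_divide_distrib[symmetric])
    have "summable (\<lambda>k. norm ((1 / fact k) * ?r ^ k))"
      using summable_norm_exp[of ?r] by (simp add: field_simps)
    then show "(\<lambda>k. (1 / fact k) * ?r ^ k) summable_on UNIV"
      by (rule norm_summable_imp_summable_on)
    show "?h (k, w) \<ge> 0" for k w
      by (auto intro!: divide_nonneg_nonneg prod_list_nonneg)
  qed
  then have "?f abs_summable_on Sigma UNIV ?W"
    by (rule Infinite_Sum.abs_summable_on_comparison_test')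
      (auto intro!: norm_prod_list_le divide_right_mono)
  then have summable: "?f summable_on Sigma UNIV ?W"
    by (rule abs_summable_summable)
  have "(?f has_sum exp (\<Sum>l\<in>L. Z l)) (Sigma UNIV ?W)"
  proof (rule has_sum_SigmaI[OF _ _ summable])
    show "((\<lambda>w. ?f (k, w)) has_sum (1 / fact k) *\<^sub>R (\<Sum>l\<in>L. Z l) ^ k) (?W k)" for k
      using has_sum_finite[OF fin, of "\<lambda>w. ?f (k, w)" k]
      by (simp add: scaleR_sum_right[symmetric] sum_prod_list_words[OF L])
    show "((\<lambda>k. (1 / fact k) *\<^sub>R (\<Sum>l\<in>L. Z l) ^ k) has_sum exp (\<Sum>l\<in>L. Z l)) UNIV"
      using norm_summable_imp_has_sum[OF summable_norm_exp exp_converges]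
      by (simp add: inverse_eq_divide)
  qed
  also have "Sigma UNIV ?W = (\<lambda>w. (length w, w)) ` {w. set w \<subseteq> L}"
    by auto
  finally show ?thesis
    by (subst (asm) has_sum_reindex) (auto simp: inj_on_def o_def)
qed

text \<open>
  The alphabet consists of the constant letter \<open>None\<close>, standing for \<open>A\<close>, and of one letter \<open>Some b\<close> for
  each variable. The scalars of a word gather into the monomial whose multi-index counts the
  occurrences of each variable.
\<close>

lemma prod_list_scaled_letters:
  fixes T :: "'b \<Rightarrow> 'a::real_algebra_1" and y :: "'b \<Rightarrow> real"
  assumes "finite B" and "set w \<subseteq> insert None (Some ` B)"
  shows "prod_list (map (\<lambda>l. case l of None \<Rightarrow> A | Some b \<Rightarrow> y b *\<^sub>R T b) w) =
    (\<Prod>b\<in>B. y b ^ count_list w (Some b)) *\<^sub>R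
      prod_list (map (\<lambda>l. case l of None \<Rightarrow> A | Some b \<Rightarrow> T b) w)"
  using assms(2)
proof (induction w)
  case (Cons l w)
  show ?case
  proof (cases l)
    case None
    then show ?thesis using Cons by simp
  next
    case (Some b)
    then have "b \<in> B" using Cons.prems by auto
    have "(\<Prod>b'\<in>B. y b' ^ count_list (l # w) (Some b')) =
        (\<Prod>b'\<in>B. (if b' = b then y b' else 1) * y b' ^ count_list w (Some b'))"
      using Some by (intro prod.cong) auto
    also have "\<dots> = y b * (\<Prod>b'\<in>B. y b' ^ count_list w (Some b'))"
      using assms(1) \<open>b \<in> B\<close> by (simp add: prod.distrib prod.delta)
    finally show ?thesis using Some Cons by simp
  qed
qed simp

text \<open>
  Regrouping the sum over words by multi-index. The coefficient \<open>c \<alpha>\<close> is itself an infinite sum,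
  since the letter \<open>A\<close> may occur any number of times; it converges as a subfamily of the word
  expansion of \<open>exp (A + (\<Sum>b\<in>B. T b))\<close>. The coefficients do not depend on the point \<open>y\<close>.
\<close>

theorem exp_affine_power_series:
  fixes A :: "'a::{real_normed_algebra_1,banach}" and T :: "'b \<Rightarrow> 'a"
  assumes B: "finite B"
  obtains c where "\<And>y. ((\<lambda>\<alpha>. (\<Prod>b\<in>B. y b ^ \<alpha> b) *\<^sub>R c \<alpha>) has_sum exp (A + (\<Sum>b\<in>B. y b *\<^sub>R T b)))
    {\<alpha>. \<forall>b. b \<notin> B \<longrightarrow> \<alpha> b = 0}"
proof -
  define L where "L = insert None (Some ` B)"
  define Z where "Z y = (\<lambda>l. case l of None \<Rightarrow> A | Some b \<Rightarrow> y b *\<^sub>R T b)" for y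
  define Z1 where "Z1 = (\<lambda>l. case l of None \<Rightarrow> A | Some b \<Rightarrow> T b)"
  define W where "W = {w. set w \<subseteq> L}"
  define letters where "letters w b = count_list w (Some b)" for w :: "'b option list" and b
  define I where "I = {\<alpha> :: 'b \<Rightarrow> nat. \<forall>b. b \<notin> B \<longrightarrow> \<alpha> b = 0}"
  define t where "t w = (1 / fact (length w)) *\<^sub>R prod_list (map Z1 w)" for w
  define c where "c \<alpha> = infsum t {w \<in> W. letters w = \<alpha>}" for \<alpha>
  have L: "finite L" using B by (simp add: L_def)
  have sumZ: "(\<Sum>l\<in>L. Z y l) = A + (\<Sum>b\<in>B. y b *\<^sub>R T b)" for y
    using B by (subst L_def, subst sum.insert) (auto simp: sum.reindex Z_def)
  have t: "t summable_on W"
    using exp_has_sum_words[OF L, of Z1] unfolding t_def W_def by (rule has_sum_imp_summable)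
  have c: "(t has_sum c \<alpha>) {w \<in> W. letters w = \<alpha>}" for \<alpha>
    unfolding c_def by (intro has_sum_infsum summable_on_subset_banach[OF t]) auto
  have "((\<lambda>\<alpha>. (\<Prod>b\<in>B. y b ^ \<alpha> b) *\<^sub>R c \<alpha>) has_sum exp (A + (\<Sum>b\<in>B. y b *\<^sub>R T b))) I" for y
  proof -
    let ?m = "\<lambda>\<alpha>. \<Prod>b\<in>B. y b ^ \<alpha> b"
    have "((\<lambda>w. (1 / fact (length w)) *\<^sub>R prod_list (map (Z y) w)) has_sum
        exp (A + (\<Sum>b\<in>B. y b *\<^sub>R T b))) W"
      using exp_has_sum_words[OF L, of "Z y"] by (simp add: sumZ W_def)
    moreover have "(1 / fact (length w)) *\<^sub>R prod_list (map (Z y) w) = ?m (letters w) *\<^sub>R t w"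
      if "w \<in> W" for w
      using prod_list_scaled_letters[OF B, of w A y T] that
      by (simp add: W_def L_def Z_def Z1_def letters_def t_def)
    ultimately have "((\<lambda>w. ?m (letters w) *\<^sub>R t w) has_sum exp (A + (\<Sum>b\<in>B. y b *\<^sub>R T b))) W"
      by (simp cong: has_sum_cong)
    also have "W = snd ` (SIGMA \<alpha>:I. {w \<in> W. letters w = \<alpha>})"
    proof -
      have "letters w \<in> I" if "w \<in> W" for w
        using that by (auto simp: I_def W_def L_def letters_def count_list_0_iff)
      then show ?thesis by force
    qed
    finally have "((\<lambda>(\<alpha>, w). ?m \<alpha> *\<^sub>R t w) has_sum exp (A + (\<Sum>b\<in>B. y b *\<^sub>R T b)))
        (SIGMA \<alpha>:I. {w \<in> W. letters w = \<alpha>})"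
      by (subst (asm) has_sum_reindex) (auto simp: inj_on_def elim!: has_sum_cong[THEN iffD1, rotated])
    then show ?thesis
      by (rule has_sum_SigmaD) (auto intro!: has_sum_scaleR c)
  qed
  then show ?thesis
    unfolding I_def by (rule that)
qed

section \<open>Multiplicative sets in Banach algebras and their tangent spaces\<close>

text \<open>The Lie algebra of \<open>H\<close>, for a subset of an arbitrary Banach algebra.\<close>

definition one_parameter_directions :: "'a::{real_normed_algebra_1,banach} set \<Rightarrow> 'a set" where
  "one_parameter_directions H = {X. \<forall>t::real. exp (t *\<^sub>R X) \<in> H}"

lemma one_parameter_directions_scaleR:
  "X \<in> one_parameter_directions H \<Longrightarrow> c *\<^sub>R X \<in> one_parameter_directions H"
  by (simp add: one_parameter_directions_def)

lemma power_in_mult_closed: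
  fixes x :: "'a::monoid_mult"
  assumes "1 \<in> H" "\<And>x y. x \<in> H \<Longrightarrow> y \<in> H \<Longrightarrow> x * y \<in> H" "x \<in> H"
  shows "x ^ n \<in> H"
  by (induction n) (use assms in auto)

text \<open>
  Closedness enters only through limits that are exponentials. A closed subgroup of \<open>GL\<close> need not
  be closed among all matrices, but it does contain its invertible limits, and exponentials are
  invertible.
\<close>

lemma subspace_one_parameter_directions:
  fixes H :: "'a::{real_normed_algebra_1,banach} set"
  assumes one: "1 \<in> H" and mult: "\<And>x y. x \<in> H \<Longrightarrow> y \<in> H \<Longrightarrow> x * y \<in> H"
    and closed: "\<And>x X. (\<And>n. x n \<in> H) \<Longrightarrow> x \<longlonglongrightarrow> exp X \<Longrightarrow> exp X \<in> H"
  shows "subspace (one_parameter_directions H)"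
  unfolding subspace_def
proof (intro conjI ballI allI)
  show "0 \<in> one_parameter_directions H"
    using one by (simp add: one_parameter_directions_def)
next
  fix X Y assume XY: "X \<in> one_parameter_directions H" "Y \<in> one_parameter_directions H"
  have "exp (t *\<^sub>R (X + Y)) \<in> H" for t
  proof -
    have "exp ((1 / real n) *\<^sub>R t *\<^sub>R Z) \<in> H" if "Z \<in> one_parameter_directions H" for n Z
      using that by (simp add: one_parameter_directions_def)
    then have "(exp ((1 / real n) *\<^sub>R t *\<^sub>R X) * exp ((1 / real n) *\<^sub>R t *\<^sub>R Y)) ^ n \<in> H" for n
      using XY by (intro power_in_mult_closed[OF one mult] mult) auto
    then have "exp (t *\<^sub>R X + t *\<^sub>R Y) \<in> H"
      by (rule closed) (rule Lie_product_formula)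
    then show ?thesis by (simp add: scaleR_add_right)
  qed
  then show "X + Y \<in> one_parameter_directions H"
    by (simp add: one_parameter_directions_def)
qed (rule one_parameter_directions_scaleR)

text \<open>
  \<open>T X\<close> is the generator of \<open>t \<mapsto> \<phi> (exp (t X))\<close>. For additivity, \<open>\<phi>\<close> maps the Lie products of
  \<open>X\<close> and \<open>Y\<close> to those of \<open>T X\<close> and \<open>T Y\<close>; passing to the limit, \<open>\<phi> (exp (X + Y))\<close> equals
  \<open>exp (T X + T Y)\<close>. Applied to all multiples \<open>t X\<close> and \<open>t Y\<close>, this identifies the generator
  belonging to \<open>X + Y\<close>.
\<close>

theorem linear_differential_exists:
  fixes H :: "'a::{real_normed_algebra_1,banach} set" and \<phi> :: "'a \<Rightarrow> 'b::{real_normed_algebra_1,banach}"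
  defines "V \<equiv> one_parameter_directions H"
  assumes one: "1 \<in> H" and mult: "\<And>x y. x \<in> H \<Longrightarrow> y \<in> H \<Longrightarrow> x * y \<in> H"
    and sub: "subspace V"
    and cont: "continuous_on H \<phi>"
    and \<phi>_one: "\<phi> 1 = 1" and \<phi>_mult: "\<And>x y. x \<in> H \<Longrightarrow> y \<in> H \<Longrightarrow> \<phi> (x * y) = \<phi> x * \<phi> y"
  obtains T where "\<And>X. X \<in> V \<Longrightarrow> \<phi> (exp X) = exp (T X)"
    and "\<And>X Y. X \<in> V \<Longrightarrow> Y \<in> V \<Longrightarrow> T (X + Y) = T X + T Y"
    and "\<And>c X. X \<in> V \<Longrightarrow> T (c *\<^sub>R X) = c *\<^sub>R T X"
proof -
  have expH: "exp (t *\<^sub>R X) \<in> H" if "X \<in> V" for X and t :: real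
    using that by (simp add: V_def one_parameter_directions_def)
  have "\<exists>Y. \<forall>t::real. \<phi> (exp (t *\<^sub>R X)) = exp (t *\<^sub>R Y)" if X: "X \<in> V" for X
  proof -
    have "exp ((s + t) *\<^sub>R X) = exp (s *\<^sub>R X) * exp (t *\<^sub>R X)" for s t :: real
      unfolding scaleR_add_left by (rule exp_add_commuting) simp
    then have "\<phi> (exp ((s + t) *\<^sub>R X)) = \<phi> (exp (s *\<^sub>R X)) * \<phi> (exp (t *\<^sub>R X))" for s t :: real
      using expH[OF X] \<phi>_mult by simp
    moreover have "continuous_on UNIV (\<lambda>t::real. \<phi> (exp (t *\<^sub>R X)))"
    proof (rule continuous_on_compose2[OF cont])
      show "continuous_on UNIV (\<lambda>t::real. exp (t *\<^sub>R X))"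
        by (rule continuous_on_vector_derivative) (rule exp_scaleR_has_vector_derivative_right)
    qed (use expH X in auto)
    ultimately show ?thesis
      using continuous_one_parameter_subgroup[of "\<lambda>t. \<phi> (exp (t *\<^sub>R X))"] \<phi>_one by force
  qed
  then obtain T where T: "\<And>X t. X \<in> V \<Longrightarrow> \<phi> (exp (t *\<^sub>R X)) = exp (t *\<^sub>R T X)" for t :: real
    by metis
  have \<phi>_power: "\<phi> (x ^ n) = \<phi> x ^ n" if "x \<in> H" for x n
    by (induction n) (use that \<phi>_one \<phi>_mult power_in_mult_closed[OF one mult] in auto)
  have exp_add: "\<phi> (exp (X + Y)) = exp (T X + T Y)" if XY: "X \<in> V" "Y \<in> V" for X Y
  proof -
    let ?p = "\<lambda>n X Y. exp ((1 / real n) *\<^sub>R X) * exp ((1 / real n) *\<^sub>R Y)"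
    have p: "?p n X Y \<in> H" for n
      by (intro mult expH XY)
    have "X + Y \<in> V" using sub XY by (rule subspace_add)
    then have "exp (X + Y) \<in> H" using expH[of "X + Y" 1] by simp
    then have "(\<lambda>n. \<phi> (?p n X Y ^ n)) \<longlonglongrightarrow> \<phi> (exp (X + Y))"
      by (intro continuous_on_tendsto_compose[OF cont Lie_product_formula])
        (simp_all add: power_in_mult_closed[OF one mult] p)
    moreover have "\<phi> (?p n X Y ^ n) = ?p n (T X) (T Y) ^ n" for n
      using p expH XY T by (simp add: \<phi>_power \<phi>_mult)
    ultimately have "(\<lambda>n. ?p n (T X) (T Y) ^ n) \<longlonglongrightarrow> \<phi> (exp (X + Y))"
      by simp
    then show ?thesis
      using Lie_product_formula LIMSEQ_unique by blast
  qed
  have scale: "T (c *\<^sub>R X) = c *\<^sub>R T X" if "X \<in> V" for c X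
  proof (rule exp_one_parameter_inject)
    show "exp (t *\<^sub>R T (c *\<^sub>R X)) = exp (t *\<^sub>R c *\<^sub>R T X)" for t
      using T[of "c *\<^sub>R X" t] T[of X "t * c"] that subspace_scale[OF sub that, of c] by simp
  qed
  show ?thesis
  proof (rule that[of T])
    show "\<phi> (exp X) = exp (T X)" if "X \<in> V" for X
      using T[OF that, of 1] by simp
    show "T (X + Y) = T X + T Y" if "X \<in> V" "Y \<in> V" for X Y
    proof (rule exp_one_parameter_inject)
      show "exp (t *\<^sub>R T (X + Y)) = exp (t *\<^sub>R (T X + T Y))" for t
        using exp_add[of "t *\<^sub>R X" "t *\<^sub>R Y"] T[of "X + Y" t] that
        by (simp add: scale subspace_scale[OF sub] subspace_add[OF sub] scaleR_add_right)
    qed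
  qed (rule scale)
qed

section \<open>Square matrices as a Banach algebra\<close>

text \<open>
  A separate type is needed because the product on \<^typ>\<open>real^'n^'n\<close> is componentwise. The operator
  norm is chosen since it is submultiplicative and gives the identity norm \<open>1\<close>; the Euclidean norm
  fails the latter.
\<close>

typedef ('n::finite) sqmat = "UNIV :: (real^'n^'n) set"
  morphisms to_matrix of_matrix ..

setup_lifting type_definition_sqmat

instantiation sqmat :: (finite) real_normed_algebra_1
begin

lift_definition zero_sqmat :: "'a sqmat" is 0 .
lift_definition one_sqmat :: "'a sqmat" is "mat 1" .
lift_definition plus_sqmat :: "'a sqmat \<Rightarrow> 'a sqmat \<Rightarrow> 'a sqmat" is "(+)" .
lift_definition minus_sqmat :: "'a sqmat \<Rightarrow> 'a sqmat \<Rightarrow> 'a sqmat" is "(-)" .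
lift_definition uminus_sqmat :: "'a sqmat \<Rightarrow> 'a sqmat" is uminus .
lift_definition times_sqmat :: "'a sqmat \<Rightarrow> 'a sqmat \<Rightarrow> 'a sqmat" is "(**)" .
lift_definition scaleR_sqmat :: "real \<Rightarrow> 'a sqmat \<Rightarrow> 'a sqmat" is "(*\<^sub>R)" .
lift_definition norm_sqmat :: "'a sqmat \<Rightarrow> real" is "\<lambda>A. onorm ((*v) A)" .

definition dist_sqmat :: "'a sqmat \<Rightarrow> 'a sqmat \<Rightarrow> real" where
  "dist_sqmat X Y = norm (X - Y)"
definition sgn_sqmat :: "'a sqmat \<Rightarrow> 'a sqmat" where
  "sgn_sqmat X = inverse (norm X) *\<^sub>R X"
definition uniformity_sqmat :: "('a sqmat \<times> 'a sqmat) filter" where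
  "uniformity_sqmat = (INF e\<in>{0<..}. principal {(x, y). dist x y < e})"
definition open_sqmat :: "'a sqmat set \<Rightarrow> bool" where
  "open_sqmat S \<longleftrightarrow> (\<forall>x\<in>S. \<forall>\<^sub>F (x', y) in uniformity. x' = x \<longrightarrow> y \<in> S)"

instance
proof
  fix X Y Z :: "'a sqmat" and a b :: real and S :: "'a sqmat set"
  show "dist X Y = norm (X - Y)" by (rule dist_sqmat_def)
  show "sgn X = inverse (norm X) *\<^sub>R X" by (rule sgn_sqmat_def)
  show "uniformity = (INF e\<in>{0<..}. principal {(x, y :: 'a sqmat). dist x y < e})"
    by (rule uniformity_sqmat_def)
  show "open S \<longleftrightarrow> (\<forall>x\<in>S. \<forall>\<^sub>F (x', y) in uniformity. x' = x \<longrightarrow> y \<in> S)"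
    by (rule open_sqmat_def)
  show "X + Y + Z = X + (Y + Z)" "X + Y = Y + X" "0 + X = X" "- X + X = 0" "X - Y = X + - Y"
    by (transfer; simp add: algebra_simps)+
  show "a *\<^sub>R (X + Y) = a *\<^sub>R X + a *\<^sub>R Y" "(a + b) *\<^sub>R X = a *\<^sub>R X + b *\<^sub>R X"
    "a *\<^sub>R b *\<^sub>R X = (a * b) *\<^sub>R X" "1 *\<^sub>R X = X"
    by (transfer; simp add: algebra_simps)+
  show "X * Y * Z = X * (Y * Z)"
    by transfer (simp add: matrix_mul_assoc)
  show "(X + Y) * Z = X * Z + Y * Z" "X * (Y + Z) = X * Y + X * Z"
    by (transfer; simp add: matrix_matrix_mult_def vec_eq_iff sum.distrib algebra_simps)+
  show "a *\<^sub>R X * Y = a *\<^sub>R (X * Y)" "X * a *\<^sub>R Y = a *\<^sub>R (X * Y)"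
    by (transfer; simp add: matrix_matrix_mult_def vec_eq_iff sum_distrib_left mult_ac)+
  show "1 * X = X" "X * 1 = X"
    by (transfer; simp)+
  show "(0 :: 'a sqmat) \<noteq> 1"
    by transfer (simp add: mat_def vec_eq_iff)
  show "norm (X + Y) \<le> norm X + norm Y"
  proof transfer
    fix A B :: "real^'a^'a"
    have "(*v) (A + B) = (\<lambda>v. A *v v + B *v v)"
      by (simp add: fun_eq_iff matrix_vector_mult_add_rdistrib)
    then show "onorm ((*v) (A + B)) \<le> onorm ((*v) A) + onorm ((*v) B)"
      by (simp add: onorm_triangle)
  qed
  show "norm X = 0 \<longleftrightarrow> X = 0"
    by transfer (simp add: onorm_eq_0 matrix_eq)
  show "norm (a *\<^sub>R X) = \<bar>a\<bar> * norm X"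
  proof transfer
    fix c :: real and A :: "real^'a^'a"
    have "(*v) (c *\<^sub>R A) = (\<lambda>v. c *\<^sub>R (A *v v))"
      by (simp add: fun_eq_iff scaleR_matrix_vector_assoc)
    then show "onorm ((*v) (c *\<^sub>R A)) = \<bar>c\<bar> * onorm ((*v) A)"
      by (simp add: onorm_scaleR)
  qed
  show "norm (X * Y) \<le> norm X * norm Y"
  proof transfer
    fix A B :: "real^'a^'a"
    have "(*v) (A ** B) = (*v) A \<circ> (*v) B"
      by (simp add: fun_eq_iff matrix_vector_mul_assoc)
    then show "onorm ((*v) (A ** B)) \<le> onorm ((*v) A) * onorm ((*v) B)"
      by (simp add: onorm_compose)
  qed
  show "norm (1 :: 'a sqmat) = 1"
  proof transfer
    have "(*v) (mat 1 :: real^'a^'a) = (\<lambda>v. v)"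
      by (simp add: fun_eq_iff)
    then show "onorm ((*v) (mat 1 :: real^'a^'a)) = 1"
      by (simp add: onorm_id)
  qed
qed

end

text \<open>
  The operator norm and the Euclidean norm are equivalent. Limits, sums and continuity therefore
  transfer between the two types, and completeness is inherited.
\<close>

lemma bounded_linear_to_matrix: "bounded_linear (to_matrix :: 'n::finite sqmat \<Rightarrow> _)"
proof (rule bounded_linear_intro)
  fix X :: "'n sqmat"
  let ?A = "to_matrix X"
  have "norm ?A \<le> (\<Sum>i\<in>UNIV. norm (?A $ i))"
    unfolding norm_vec_def by (rule L2_set_le_sum) simp
  also have "\<dots> \<le> (\<Sum>i\<in>UNIV. \<Sum>j\<in>UNIV. \<bar>?A $ i $ j\<bar>)"
    by (intro sum_mono norm_le_l1_cart)
  also have "\<dots> \<le> (\<Sum>i\<in>(UNIV::'n set). \<Sum>j\<in>(UNIV::'n set). norm X)"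
    unfolding norm_sqmat.rep_eq by (intro sum_mono matrix_component_le_onorm)
  also have "\<dots> = norm X * (real CARD('n) * real CARD('n))"
    by simp
  finally show "norm ?A \<le> norm X * (real CARD('n) * real CARD('n))" .
qed (simp_all add: plus_sqmat.rep_eq scaleR_sqmat.rep_eq)

lemma bounded_linear_of_matrix: "bounded_linear (of_matrix :: _ \<Rightarrow> 'n::finite sqmat)"
  unfolding linear_conv_bounded_linear[symmetric]
  by (rule linearI) (transfer, simp)+

lemma to_of_matrix [simp]: "to_matrix (of_matrix A) = A"
  by (simp add: of_matrix_inverse)

lemma of_to_matrix [simp]: "of_matrix (to_matrix X) = X"
  by (rule to_matrix_inverse)

lemma of_matrix_mult: "of_matrix (A ** B) = of_matrix A * of_matrix B"
  by transfer simp

lemma of_matrix_one: "of_matrix (mat 1) = 1"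
  by transfer simp

instance sqmat :: (finite) banach
proof
  fix X :: "nat \<Rightarrow> 'a sqmat" assume "Cauchy X"
  then have "Cauchy (\<lambda>n. to_matrix (X n))"
    by (rule bounded_linear.Cauchy[OF bounded_linear_to_matrix])
  then obtain A where "(\<lambda>n. to_matrix (X n)) \<longlonglongrightarrow> A"
    using Cauchy_convergent convergent_def by blast
  then have "(\<lambda>n. of_matrix (to_matrix (X n))) \<longlonglongrightarrow> of_matrix A"
    by (rule bounded_linear.tendsto[OF bounded_linear_of_matrix])
  then show "convergent X"
    by (auto simp: convergent_def)
qed

lemma mat_exp_eq: "mat_exp A = to_matrix (exp (of_matrix A))"
proof -
  have "((**) A ^^ k) (mat 1) = to_matrix (of_matrix A ^ k)" for k
    by (induction k) (simp_all add: one_sqmat.rep_eq times_sqmat.rep_eq)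
  then have "mat_exp A = (\<Sum>k. to_matrix (of_matrix A ^ k /\<^sub>R fact k))"
    by (simp add: mat_exp_def scaleR_sqmat.rep_eq inverse_eq_divide)
  also have "\<dots> = to_matrix (exp (of_matrix A))"
    unfolding exp_def
    by (rule bounded_linear.suminf[OF bounded_linear_to_matrix, symmetric])
      (rule summable_exp_generic)
  finally show ?thesis .
qed

lemma of_matrix_scaleR: "of_matrix (c *\<^sub>R A) = c *\<^sub>R of_matrix A"
  by transfer simp

lemma of_matrix_add: "of_matrix (A + B) = of_matrix A + of_matrix B"
  by transfer simp

section \<open>Continuous homomorphisms of matrix Lie groups\<close>

definition sqmats :: "(real^'n^'n) set \<Rightarrow> 'n::finite sqmat set" where
  "sqmats G = {X. to_matrix X \<in> G}"

lemma matrix_lie_group_one: "matrix_lie_group G \<Longrightarrow> mat 1 \<in> G"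
  using subgroup.one_closed[of G GL] by (simp add: matrix_lie_group_def GL_def)

lemma matrix_lie_group_mult: "matrix_lie_group G \<Longrightarrow> A \<in> G \<Longrightarrow> B \<in> G \<Longrightarrow> A ** B \<in> G"
  using subgroup.m_closed[of G GL] by (simp add: matrix_lie_group_def GL_def)

lemma matrix_lie_group_invertible: "matrix_lie_group G \<Longrightarrow> A \<in> G \<Longrightarrow> invertible A"
  using subgroup.subset[of G GL] by (auto simp: matrix_lie_group_def GL_def)

lemma one_in_sqmats: "matrix_lie_group G \<Longrightarrow> 1 \<in> sqmats G"
  by (simp add: sqmats_def one_sqmat.rep_eq matrix_lie_group_one)

lemma mult_in_sqmats: "matrix_lie_group G \<Longrightarrow> X \<in> sqmats G \<Longrightarrow> Y \<in> sqmats G \<Longrightarrow> X * Y \<in> sqmats G"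
  by (simp add: sqmats_def times_sqmat.rep_eq matrix_lie_group_mult)

lemma invertible_to_matrix_exp: "invertible (to_matrix (exp X))"
  unfolding invertible_def
proof (intro exI conjI)
  show "to_matrix (exp X) ** to_matrix (exp (- X)) = mat 1"
    by (simp add: times_sqmat.rep_eq[symmetric] one_sqmat.rep_eq[symmetric] exp_minus_inverse)
  show "to_matrix (exp (- X)) ** to_matrix (exp X) = mat 1"
    using exp_minus_inverse[of "- X"]
    by (simp add: times_sqmat.rep_eq[symmetric] one_sqmat.rep_eq[symmetric])
qed

lemma exp_limit_in_sqmats:
  assumes G: "matrix_lie_group G" and x: "\<And>n. x n \<in> sqmats G" "x \<longlonglongrightarrow> exp X"
  shows "exp X \<in> sqmats G"
proof -
  obtain C where C: "closed C" "G = carrier GL \<inter> C"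
    using G by (auto simp: matrix_lie_group_def closedin_closed)
  have "(\<lambda>n. to_matrix (x n)) \<longlonglongrightarrow> to_matrix (exp X)"
    by (rule bounded_linear.tendsto[OF bounded_linear_to_matrix x(2)])
  then have "to_matrix (exp X) \<in> C"
    by (rule closed_sequentially[OF C(1), rotated]) (use x(1) C(2) in \<open>auto simp: sqmats_def\<close>)
  then show ?thesis
    using C(2) invertible_to_matrix_exp by (auto simp: sqmats_def GL_def)
qed

lemma lie_algebra_eq_vimage:
  "lie_algebra G = of_matrix -` one_parameter_directions (sqmats G)"
  by (auto simp: lie_algebra_def one_parameter_directions_def sqmats_def mat_exp_eq of_matrix_scaleR)

lemma subspace_one_parameter_directions_sqmats:
  "matrix_lie_group G \<Longrightarrow> subspace (one_parameter_directions (sqmats G))"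
  by (rule subspace_one_parameter_directions)
    (auto intro: one_in_sqmats mult_in_sqmats exp_limit_in_sqmats)

lemma subspace_lie_algebra: "matrix_lie_group G \<Longrightarrow> subspace (lie_algebra G)"
  unfolding lie_algebra_eq_vimage
  by (rule linear_subspace_vimage[OF bounded_linear.linear[OF bounded_linear_of_matrix]])
    (rule subspace_one_parameter_directions_sqmats)

lemma mat_exp_in_group: "X \<in> lie_algebra G \<Longrightarrow> mat_exp X \<in> G"
  unfolding lie_algebra_def by (metis (mono_tags) mem_Collect_eq scaleR_one)

text \<open>
  Passes from coordinates of a point of \<open>V\<close> to coordinates of its image, for a map that is linear on
  \<open>V\<close> and arbitrary elsewhere, as the differential of a homomorphism is.
\<close>

lemma additive_on_subspace_sum:
  assumes V: "subspace V" and finB: "finite B" and B: "B \<subseteq> V" and a: "a \<in> V"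
    and add: "\<And>x y. x \<in> V \<Longrightarrow> y \<in> V \<Longrightarrow> T (x + y) = T x + T y"
    and scale: "\<And>c x. x \<in> V \<Longrightarrow> T (c *\<^sub>R x) = c *\<^sub>R T x"
  shows "T (a + (\<Sum>b\<in>B. y b *\<^sub>R b)) = T a + (\<Sum>b\<in>B. y b *\<^sub>R T b)"
  using finB B
proof (induction B)
  case (insert b B)
  have "T (a + (\<Sum>b\<in>insert b B. y b *\<^sub>R b)) = T (y b *\<^sub>R b + (a + (\<Sum>b\<in>B. y b *\<^sub>R b)))"
    using insert by (simp add: add.left_commute)
  also have "\<dots> = T (y b *\<^sub>R b) + T (a + (\<Sum>b\<in>B. y b *\<^sub>R b))"
    using insert.prems by (intro add subspace_scale[OF V] subspace_add[OF V] subspace_sum[OF V] a) auto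
  finally show ?case
    using insert scale by (simp add: add.left_commute)
qed simp

text \<open>
  The homomorphism in exponential coordinates: \<open>linear_differential_exists\<close> for the matrix
  algebra, pulled back along \<^const>\<open>of_matrix\<close>.
\<close>

lemma continuous_hom_exp:
  fixes G1 :: "(real^'n^'n) set" and G2 :: "(real^'m^'m) set"
  assumes G1: "matrix_lie_group G1" and G2: "matrix_lie_group G2"
    and hom: "f \<in> hom (GL\<lparr>carrier := G1\<rparr>) (GL\<lparr>carrier := G2\<rparr>)"
    and cont: "continuous_on G1 f"
  obtains T :: "real^'n^'n \<Rightarrow> 'm sqmat"
  where "\<And>X. X \<in> lie_algebra G1 \<Longrightarrow> f (mat_exp X) = to_matrix (exp (T X))"
    and "\<And>X Y. X \<in> lie_algebra G1 \<Longrightarrow> Y \<in> lie_algebra G1 \<Longrightarrow> T (X + Y) = T X + T Y"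
    and "\<And>c X. X \<in> lie_algebra G1 \<Longrightarrow> T (c *\<^sub>R X) = c *\<^sub>R T X"
proof -
  have f_mult: "f (A ** B) = f A ** f B" if "A \<in> G1" "B \<in> G1" for A B
    using hom_mult[OF hom] that by (simp add: GL_def)
  have f_one: "f (mat 1) = mat 1"
  proof -
    have "f (mat 1) \<in> G2"
      using hom_in_carrier[OF hom] matrix_lie_group_one[OF G1] by simp
    then obtain B where "f (mat 1) ** B = mat 1"
      using matrix_lie_group_invertible[OF G2] by (auto simp: invertible_def)
    moreover have "f (mat 1) ** f (mat 1) = f (mat 1)"
      using f_mult[of "mat 1" "mat 1"] matrix_lie_group_one[OF G1] by simp
    ultimately show ?thesis
      by (metis matrix_mul_assoc matrix_mul_rid)
  qed
  define \<phi> where "\<phi> X = of_matrix (f (to_matrix X))" for X :: "'n sqmat"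
  have "continuous_on (sqmats G1) (f \<circ> to_matrix)"
    by (intro continuous_on_compose continuous_on_subset[OF cont]
        linear_continuous_on bounded_linear_to_matrix) (auto simp: sqmats_def)
  then have \<phi>_cont: "continuous_on (sqmats G1) \<phi>"
    unfolding \<phi>_def o_def by (rule bounded_linear.continuous_on[OF bounded_linear_of_matrix])
  obtain T where T:
    "\<And>X. X \<in> one_parameter_directions (sqmats G1) \<Longrightarrow> \<phi> (exp X) = exp (T X)"
    "\<And>X Y. X \<in> one_parameter_directions (sqmats G1) \<Longrightarrow> Y \<in> one_parameter_directions (sqmats G1)
      \<Longrightarrow> T (X + Y) = T X + T Y"
    "\<And>c X. X \<in> one_parameter_directions (sqmats G1) \<Longrightarrow> T (c *\<^sub>R X) = c *\<^sub>R T X"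
  proof (rule linear_differential_exists[of "sqmats G1" \<phi>])
    show "\<phi> 1 = 1"
      by (simp add: \<phi>_def one_sqmat.rep_eq f_one of_matrix_one)
    show "\<phi> (X * Y) = \<phi> X * \<phi> Y" if "X \<in> sqmats G1" "Y \<in> sqmats G1" for X Y
      using that by (simp add: \<phi>_def sqmats_def times_sqmat.rep_eq f_mult of_matrix_mult)
  qed (use G1 \<phi>_cont in \<open>auto intro: one_in_sqmats mult_in_sqmats subspace_one_parameter_directions_sqmats\<close>)
  show ?thesis
  proof (rule that[of "\<lambda>X. T (of_matrix X)"])
    fix X assume "X \<in> lie_algebra G1"
    then have "of_matrix (f (mat_exp X)) = exp (T (of_matrix X))"
      using T(1)[of "of_matrix X"] by (simp add: lie_algebra_eq_vimage \<phi>_def mat_exp_eq)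
    then show "f (mat_exp X) = to_matrix (exp (T (of_matrix X)))"
      by (metis to_of_matrix)
  qed (use T(2,3) in \<open>auto simp: lie_algebra_eq_vimage of_matrix_add of_matrix_scaleR\<close>)
qed

text \<open>
  In a chart at \<open>g\<close> the map is \<open>x \<mapsto> f g ** exp (T x)\<close>. Expanding \<open>T x\<close> around \<open>a\<close> in a basis \<open>B\<close> of
  the Lie algebra brings it into the form of \<open>exp_affine_power_series\<close>, and the multiplication
  by \<open>f g\<close>, being bounded and linear, is applied to each coefficient.
\<close>

theorem corollary1p13:
  fixes G1 :: "(real^'n^'n) set" and G2 :: "(real^'m^'m) set"
    and U :: "(real^'n^'n) set" and f :: "real^'n^'n \<Rightarrow> real^'m^'m"
  assumes "matrix_lie_group G1" and "matrix_lie_group G2"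
    and "exp_chart_domain U"
    and "f \<in> hom (GL\<lparr>carrier := G1\<rparr>) (GL\<lparr>carrier := G2\<rparr>)"
    and "continuous_on G1 f"
  shows "lie_analytic U G1 f"
proof -
  let ?V = "lie_algebra G1"
  obtain T :: "real^'n^'n \<Rightarrow> 'm sqmat" where T:
    "\<And>X. X \<in> ?V \<Longrightarrow> f (mat_exp X) = to_matrix (exp (T X))"
    "\<And>X Y. X \<in> ?V \<Longrightarrow> Y \<in> ?V \<Longrightarrow> T (X + Y) = T X + T Y"
    "\<And>c X. X \<in> ?V \<Longrightarrow> T (c *\<^sub>R X) = c *\<^sub>R T X"
    using continuous_hom_exp[OF assms(1,2,4,5)] by blast
  have V: "subspace ?V"
    by (rule subspace_lie_algebra[OF assms(1)])
  have expansion: "\<exists>c. \<forall>x\<in>?V. ((\<lambda>\<alpha>. (\<Prod>b\<in>B. representation B (x - a) b ^ \<alpha> b) *\<^sub>R c \<alpha>)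
        has_sum f (g ** mat_exp x)) {\<alpha>. \<forall>b. b \<notin> B \<longrightarrow> \<alpha> b = 0}"
    if g: "g \<in> G1" and B: "independent B" "span B = ?V" and a: "a \<in> ?V" for g a B
  proof -
    have finB: "finite B" and BV: "B \<subseteq> ?V"
      using B independent_imp_finite span_superset by auto
    obtain c where c: "\<And>y. ((\<lambda>\<alpha>. (\<Prod>b\<in>B. y b ^ \<alpha> b) *\<^sub>R c \<alpha>) has_sum
        exp (T a + (\<Sum>b\<in>B. y b *\<^sub>R T b))) {\<alpha>. \<forall>b. b \<notin> B \<longrightarrow> \<alpha> b = 0}"
      using exp_affine_power_series[OF finB] by blast
    have lin: "bounded_linear (\<lambda>Y. f g ** to_matrix Y)"
      using bounded_linear_compose[OF bounded_linear_to_matrix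
          bounded_linear_mult_right[of "of_matrix (f g)"]]
      by (simp add: times_sqmat.rep_eq)
    have "((\<lambda>\<alpha>. (\<Prod>b\<in>B. representation B (x - a) b ^ \<alpha> b) *\<^sub>R (f g ** to_matrix (c \<alpha>)))
        has_sum f (g ** mat_exp x)) {\<alpha>. \<forall>b. b \<notin> B \<longrightarrow> \<alpha> b = 0}" if x: "x \<in> ?V" for x
    proof -
      let ?y = "representation B (x - a)"
      have "x - a \<in> span B"
        using subspace_diff[OF V x a] B by simp
      then have coords: "a + (\<Sum>b\<in>B. ?y b *\<^sub>R b) = x"
        using real_vector.sum_representation_eq[OF B(1) _ finB order_refl] by simp
      have "T x = T a + (\<Sum>b\<in>B. ?y b *\<^sub>R T b)"
        using additive_on_subspace_sum[of ?V B a T ?y, OF V finB BV a T(2,3)]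
        unfolding coords .
      moreover have "f (g ** mat_exp x) = f g ** to_matrix (exp (T x))"
        using hom_mult[OF assms(4), of g "mat_exp x"] g mat_exp_in_group[OF x] T(1)[OF x]
        by (simp add: GL_def)
      ultimately show ?thesis
        using has_sum_bounded_linear[OF lin c[of ?y]]
        by (simp add: o_def linear_scale[OF bounded_linear.linear[OF lin]])
    qed
    then show ?thesis
      by (intro exI[of _ "\<lambda>\<alpha>. f g ** to_matrix (c \<alpha>)"] ballI)
  qed
  have "\<exists>c. \<exists>r>0. \<forall>x\<in>?V \<inter> U. dist x a < r \<longrightarrow>
      ((\<lambda>\<alpha>. (\<Prod>b\<in>B. representation B (x - a) b ^ \<alpha> b) *\<^sub>R c \<alpha>)
        has_sum (f \<circ> lie_chart g) x) {\<alpha>. \<forall>b. b \<notin> B \<longrightarrow> \<alpha> b = 0}"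
    if g: "g \<in> G1" and B: "independent B" "span B = ?V" and a: "a \<in> ?V \<inter> U" for g a B
  proof -
    obtain c where "\<forall>x\<in>?V. ((\<lambda>\<alpha>. (\<Prod>b\<in>B. representation B (x - a) b ^ \<alpha> b) *\<^sub>R c \<alpha>)
        has_sum f (g ** mat_exp x)) {\<alpha>. \<forall>b. b \<notin> B \<longrightarrow> \<alpha> b = 0}"
      using expansion[OF g B IntD1[OF a]] by (elim exE)
    (* The expansion holds on the whole Lie algebra, so any positive radius serves. *)
    then show ?thesis
      by (intro exI[of _ c] exI[of _ "1::real"]) (simp add: lie_chart_def)
  qed
  moreover have "openin (top_of_set ?V) (?V \<inter> U)"
    using assms(3) by (auto simp: exp_chart_domain_def)
  ultimately show ?thesis
    unfolding lie_analytic_def real_analytic_on_def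
    using V by (intro conjI ballI allI impI) auto
qed

end
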